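(* For all integers $n,k$ with $n\ge k+1\ge 2$, $$f(n,k)=\sum_{i=0}^{n-k-1}\binom{n-k-1}{i}\frac{(2^{k}-1)^i}{2^{k(n-k)}}\,f(n-k,i).$$
   Context: For $n\ge2$, the complete graph $K_n$ on the vertex set $[n]=\{1,\dots,n\}$ is randomly oriented: each edge is independently given one of its two possible directions, each with probability $\frac12$; $P_n$ denotes the corresponding probability. For vertices $u\neq v$, $\{u\nrightarrow v\}$ is the event that there is no directed path from $u$ to $v$. For $s\in[n]$ and $K\subset[n]\setminus\{s\}$, let $\{K\nrightarrow s\}$ be the event that $a\nrightarrow s$ for every $a\in K$. With $|K|=k$ (so $0\le k\le n-1$) define $f(n,k):=P_n(K\nrightarrow s)$, which depends only on $n$ and $k$; in particular $f(n,0)=1$. Also set $f(1,0):=1$. *)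

theory Defs
  imports "HOL-Probability.Probability" "Graph_Theory.Graph_Theory"
begin

definition Kn_edges :: "nat \<Rightarrow> nat set set" where
  "Kn_edges n = {e. e \<subseteq> {1..n} \<and> card e = 2}"

text \<open>
  An orientation maps every edge to the endpoint it points to; off the edge set it
  has the dummy value \<open>undefined\<close>.
\<close>
definition random_orientation :: "nat \<Rightarrow> (nat set \<Rightarrow> nat) pmf" where
  "random_orientation n = Pi_pmf (Kn_edges n) undefined pmf_of_set"

definition oriented_Kn :: "nat \<Rightarrow> (nat set \<Rightarrow> nat) \<Rightarrow> nat pair_pre_digraph" where
  "oriented_Kn n \<omega> = \<lparr> pverts = {1..n}, parcs = {(u, v). {u, v} \<in> Kn_edges n \<and> \<omega> {u, v} = v} \<rparr>"

definition no_path :: "nat \<Rightarrow> (nat set \<Rightarrow> nat) \<Rightarrow> nat \<Rightarrow> nat \<Rightarrow> bool" where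
  "no_path n \<omega> u v \<longleftrightarrow> (\<nexists>p. pre_digraph.apath (with_proj (oriented_Kn n \<omega>)) u p v)"

definition prob_no_path :: "nat \<Rightarrow> nat set \<Rightarrow> nat \<Rightarrow> real" where
  "prob_no_path n K s = measure_pmf.prob (random_orientation n) {\<omega>. \<forall>a\<in>K. no_path n \<omega> a s}"

text \<open>
  The description in \<open>f\<close> is meaningful for \<open>0 \<le> k \<le> n - 1\<close>; see \<open>f_eq\<close> below for
  the independence of the choice of \<open>K\<close> and \<open>s\<close>.
\<close>
definition f :: "nat \<Rightarrow> nat \<Rightarrow> real" where
  "f n k = (THE p. \<forall>s\<in>{1..n}. \<forall>K. K \<subseteq> {1..n} - {s} \<and> card K = k \<longrightarrow> prob_no_path n K s = p)"

lemma finite_Kn_edges [simp]: "finite (Kn_edges n)"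
  by (rule finite_subset[of _ "Pow {1..n}"]) (auto simp: Kn_edges_def)

lemma random_orientation_altdef:
  "random_orientation n = pmf_of_set (PiE_dflt (Kn_edges n) undefined id)"
proof -
  have "finite e \<and> e \<noteq> {}" if "e \<in> Kn_edges n" for e
    using that by (auto simp: Kn_edges_def intro: finite_subset)
  then show ?thesis
    unfolding random_orientation_def by (subst Pi_pmf_of_set[symmetric]) auto
qed

lemma wf_oriented_Kn: "wf_digraph (with_proj (oriented_Kn n \<omega>))"
  by unfold_locales (auto simp: oriented_Kn_def Kn_edges_def)

lemma no_path_iff_rtrancl:
  assumes "u \<in> {1..n}"
  shows "no_path n \<omega> u v \<longleftrightarrow> (u, v) \<notin> (parcs (oriented_Kn n \<omega>))\<^sup>*"
proof -
  interpret wf_digraph "with_proj (oriented_Kn n \<omega>)" by (rule wf_oriented_Kn)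
  have "(u, v) \<in> rtrancl_on {1..n} (parcs (oriented_Kn n \<omega>))"
    if "(u, v) \<in> (parcs (oriented_Kn n \<omega>))\<^sup>*" for v
    using that
  proof induction
    case base
    show ?case using assms by auto
  next
    case (step v w)
    then show ?case
      by (auto intro!: rtrancl_on_into_rtrancl_on[of _ v] simp: oriented_Kn_def Kn_edges_def)
  qed
  moreover have "(u, v) \<in> (parcs (oriented_Kn n \<omega>))\<^sup>*"
    if "(u, v) \<in> rtrancl_on {1..n} (parcs (oriented_Kn n \<omega>))" for v
    using that by (rule rtrancl_on_rtranclI)
  moreover have "u \<rightarrow>\<^sup>*\<^bsub>with_proj (oriented_Kn n \<omega>)\<^esub> v \<longleftrightarrow>
      (u, v) \<in> rtrancl_on {1..n} (parcs (oriented_Kn n \<omega>))"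
    by (simp add: reachable_def) (simp add: oriented_Kn_def)
  ultimately show ?thesis
    unfolding no_path_def reachable_apath[symmetric] by blast
qed

definition permute_orientation ::
    "nat \<Rightarrow> (nat \<Rightarrow> nat) \<Rightarrow> (nat set \<Rightarrow> nat) \<Rightarrow> nat set \<Rightarrow> nat" where
  "permute_orientation n \<pi> \<omega> =
     (\<lambda>e. if e \<in> Kn_edges n then \<pi> (\<omega> (inv \<pi> ` e)) else undefined)"

lemma image_Kn_edges_iff:
  assumes "\<pi> permutes {1..n}"
  shows "\<pi> ` e \<in> Kn_edges n \<longleftrightarrow> e \<in> Kn_edges n"
proof -
  have "\<pi> ` e \<subseteq> {1..n} \<longleftrightarrow> e \<subseteq> {1..n}"
    using permutes_in_image[OF assms] by blast
  moreover have "card (\<pi> ` e) = card e"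
    using permutes_inj[OF assms] by (intro card_image) (auto intro: inj_on_subset)
  ultimately show ?thesis by (simp add: Kn_edges_def)
qed

lemma permute_orientation_in:
  assumes "\<pi> permutes {1..n}" "\<omega> \<in> PiE_dflt (Kn_edges n) undefined id"
  shows "permute_orientation n \<pi> \<omega> \<in> PiE_dflt (Kn_edges n) undefined id"
  unfolding PiE_dflt_def
proof (intro CollectI allI conjI impI)
  fix e
  assume e: "e \<in> Kn_edges n"
  have "inv \<pi> ` e \<in> Kn_edges n"
    using e image_Kn_edges_iff[OF permutes_inv[OF assms(1)]] by simp
  then have "\<omega> (inv \<pi> ` e) \<in> inv \<pi> ` e"
    using assms(2) by (auto simp: PiE_dflt_def)
  then show "permute_orientation n \<pi> \<omega> e \<in> id e"
    using e by (auto simp: permute_orientation_def permutes_inverses[OF assms(1)])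
qed (auto simp: permute_orientation_def)

lemma permute_orientation_inverse:
  assumes "\<pi> permutes {1..n}" "\<omega> \<in> PiE_dflt (Kn_edges n) undefined id"
  shows "permute_orientation n (inv \<pi>) (permute_orientation n \<pi> \<omega>) = \<omega>"
proof
  fix e
  have "inv \<pi> ` \<pi> ` e = e"
    by (auto simp: image_image permutes_inverses[OF assms(1)])
  then show "permute_orientation n (inv \<pi>) (permute_orientation n \<pi> \<omega>) e = \<omega> e"
    using assms(2) image_Kn_edges_iff[OF assms(1)]
    by (auto simp: permute_orientation_def PiE_dflt_def permutes_inv_inv[OF assms(1)]
          permutes_inverses[OF assms(1)])
qed

lemma bij_betw_permute_orientation:
  assumes "\<pi> permutes {1..n}"
  shows "bij_betw (permute_orientation n \<pi>)
           (PiE_dflt (Kn_edges n) undefined id) (PiE_dflt (Kn_edges n) undefined id)"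
proof (rule bij_betw_byWitness[where f' = "permute_orientation n (inv \<pi>)"])
  have inv: "inv \<pi> permutes {1..n}" "inv (inv \<pi>) = \<pi>"
    using assms by (simp_all add: permutes_inv permutes_inv_inv)
  show "\<forall>\<omega>\<in>PiE_dflt (Kn_edges n) undefined id.
      permute_orientation n (inv \<pi>) (permute_orientation n \<pi> \<omega>) = \<omega>"
    using permute_orientation_inverse[OF assms] by blast
  show "\<forall>\<omega>\<in>PiE_dflt (Kn_edges n) undefined id.
      permute_orientation n \<pi> (permute_orientation n (inv \<pi>) \<omega>) = \<omega>"
    using permute_orientation_inverse[OF inv(1)] inv(2) by simp
  show "permute_orientation n \<pi> ` PiE_dflt (Kn_edges n) undefined id
      \<subseteq> PiE_dflt (Kn_edges n) undefined id"
    using permute_orientation_in[OF assms] by blast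
  show "permute_orientation n (inv \<pi>) ` PiE_dflt (Kn_edges n) undefined id
      \<subseteq> PiE_dflt (Kn_edges n) undefined id"
    using permute_orientation_in[OF inv(1)] by blast
qed

lemma parcs_permute_orientation:
  assumes "\<pi> permutes {1..n}"
  shows "(\<pi> u, \<pi> v) \<in> parcs (oriented_Kn n (permute_orientation n \<pi> \<omega>)) \<longleftrightarrow>
         (u, v) \<in> parcs (oriented_Kn n \<omega>)"
proof -
  have "{\<pi> u, \<pi> v} \<in> Kn_edges n \<longleftrightarrow> {u, v} \<in> Kn_edges n"
    using image_Kn_edges_iff[OF assms, of "{u, v}"] by simp
  then show ?thesis
    using permutes_inj[OF assms]
    by (auto simp: oriented_Kn_def permute_orientation_def permutes_inverses[OF assms] inj_eq)
qed

lemma no_path_permute_orientation: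
  assumes "\<pi> permutes {1..n}" "u \<in> {1..n}"
  shows "no_path n (permute_orientation n \<pi> \<omega>) (\<pi> u) (\<pi> v) \<longleftrightarrow> no_path n \<omega> u v"
proof -
  let ?R = "parcs (oriented_Kn n \<omega>)"
  let ?S = "parcs (oriented_Kn n (permute_orientation n \<pi> \<omega>))"
  have "(\<pi> u, \<pi> w) \<in> ?S\<^sup>*" if "(u, w) \<in> ?R\<^sup>*" for w
    using that
    by induction (auto intro: rtrancl_into_rtrancl
        simp: parcs_permute_orientation[OF assms(1)])
  moreover have "(u, inv \<pi> w) \<in> ?R\<^sup>*" if "(\<pi> u, w) \<in> ?S\<^sup>*" for w
    using that
  proof induction
    case base
    then show ?case by (simp add: permutes_inverses[OF assms(1)])
  next
    case (step w x)
    have "(inv \<pi> w, inv \<pi> x) \<in> ?R"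
      using step(2) parcs_permute_orientation[OF assms(1), of "inv \<pi> w" "inv \<pi> x"]
      by (simp add: permutes_inverses[OF assms(1)])
    then show ?case using step by (auto intro: rtrancl_into_rtrancl)
  qed
  from this[of "\<pi> v"] have "(u, v) \<in> ?R\<^sup>*" if "(\<pi> u, \<pi> v) \<in> ?S\<^sup>*"
    using that by (simp add: permutes_inverses[OF assms(1)])
  moreover have "\<pi> u \<in> {1..n}"
    using permutes_in_image[OF assms(1)] assms(2) by blast
  ultimately show ?thesis
    using assms(2) by (auto simp: no_path_iff_rtrancl)
qed

lemma prob_no_path_permute:
  assumes "\<pi> permutes {1..n}" "K \<subseteq> {1..n}"
  shows "prob_no_path n (\<pi> ` K) (\<pi> s) = prob_no_path n K s"
proof -
  let ?A = "PiE_dflt (Kn_edges n) undefined id"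
  have "?A \<noteq> {}" "finite ?A"
  proof -
    have "finite e \<and> e \<noteq> {}" if "e \<in> Kn_edges n" for e
      using that by (auto simp: Kn_edges_def intro: finite_subset)
    then show "?A \<noteq> {}" "finite ?A" by (auto intro!: finite_PiE_dflt)
  qed
  then have "random_orientation n = map_pmf (permute_orientation n \<pi>) (random_orientation n)"
    unfolding random_orientation_altdef
    by (intro map_pmf_of_set_bij_betw[symmetric] bij_betw_permute_orientation assms)
  then have "prob_no_path n (\<pi> ` K) (\<pi> s) = measure_pmf.prob
      (map_pmf (permute_orientation n \<pi>) (random_orientation n))
      {\<omega>. \<forall>a\<in>\<pi> ` K. no_path n \<omega> a (\<pi> s)}"
    unfolding prob_no_path_def by simp
  also have "\<dots> = measure_pmf.prob (random_orientation n)
      {\<omega>. \<forall>a\<in>K. no_path n (permute_orientation n \<pi> \<omega>) (\<pi> a) (\<pi> s)}"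
    by (simp add: vimage_def)
  also have "{\<omega>. \<forall>a\<in>K. no_path n (permute_orientation n \<pi> \<omega>) (\<pi> a) (\<pi> s)}
      = {\<omega>. \<forall>a\<in>K. no_path n \<omega> a s}"
    using no_path_permute_orientation[OF assms(1)] assms(2) by blast
  finally show ?thesis by (simp add: prob_no_path_def)
qed

lemma prob_no_path_cong_card:
  assumes "s \<in> {1..n}" "K \<subseteq> {1..n} - {s}" "s' \<in> {1..n}" "K' \<subseteq> {1..n} - {s'}"
    and "card K = card K'"
  shows "prob_no_path n K s = prob_no_path n K' s'"
proof -
  have fin: "finite K" "finite K'"
    using assms by (auto intro: finite_subset)
  then obtain g where g: "bij_betw g K K'"
    using assms(5) finite_same_card_bij by blast
  let ?L = "{1..n} - insert s K" and ?L' = "{1..n} - insert s' K'"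
  have "card (insert s K) = card (insert s' K')"
    using assms fin by (subst (1 2) card_insert_disjoint) auto
  moreover have "insert s K \<subseteq> {1..n}" "insert s' K' \<subseteq> {1..n}"
    using assms by auto
  ultimately have "card ?L = card ?L'"
    using fin by (simp add: card_Diff_subset)
  then obtain h where h: "bij_betw h ?L ?L'"
    using finite_same_card_bij[of ?L ?L'] by auto
  define \<pi> where "\<pi> = (\<lambda>x. if x = s then s' else if x \<in> K then g x
    else if x \<in> {1..n} then h x else x)"
  have 1: "bij_betw \<pi> {s} {s'}"
    by (simp add: \<pi>_def)
  have 2: "bij_betw \<pi> K K'"
    using g assms(2) by (subst bij_betw_cong[of _ _ g]) (auto simp: \<pi>_def)
  have 3: "bij_betw \<pi> ?L ?L'"
    using h by (subst bij_betw_cong[of _ _ h]) (auto simp: \<pi>_def)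
  have "bij_betw \<pi> ({s} \<union> K \<union> ?L) ({s'} \<union> K' \<union> ?L')"
    by (rule bij_betw_combine[OF bij_betw_combine[OF 1 2] 3]) (use assms in auto)
  moreover have "{s} \<union> K \<union> ?L = {1..n}" "{s'} \<union> K' \<union> ?L' = {1..n}"
    using assms by auto
  ultimately have "\<pi> permutes {1..n}"
    by (intro bij_imp_permutes) (use assms in \<open>auto simp: \<pi>_def\<close>)
  moreover have "\<pi> ` K = K'" "\<pi> s = s'"
    using 2 by (auto simp: bij_betw_def \<pi>_def)
  ultimately show ?thesis
    using prob_no_path_permute[of \<pi> n K s] assms(2) by (metis Diff_subset subset_trans)
qed

lemma f_eq:
  assumes "s \<in> {1..n}" "K \<subseteq> {1..n} - {s}" "card K = k"
  shows "f n k = prob_no_path n K s"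
proof -
  have "\<forall>t\<in>{1..n}. \<forall>L. L \<subseteq> {1..n} - {t} \<and> card L = k
      \<longrightarrow> prob_no_path n L t = prob_no_path n K s"
    using prob_no_path_cong_card[OF _ _ assms(1,2)] assms(3) by simp
  then show ?thesis
    unfolding f_def by (rule the_equality) (use assms in simp)
qed

lemma f_0:
  assumes "n \<ge> 1"
  shows "f n 0 = 1"
  using f_eq[of 1 n "{}" 0] assms by (simp add: prob_no_path_def)

end

theory Submission
  imports Defs
begin

text \<open>
  Put \<open>m = n - k\<close>, and by symmetry take \<open>s = 1\<close> and \<open>K = {m<..n}\<close>, so that the remaining vertices
  span the complete graph on \<open>{1..m}\<close>. Cut a path from \<open>K\<close> to \<open>s\<close> after its last vertex in \<open>K\<close>:
  what is left starts at a vertex of the entry set \<open>A\<close>, the set of those \<open>v \<le> m\<close> that receive an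
  edge from \<open>K\<close>, and runs inside \<open>{1..m}\<close>. Hence \<open>K\<close> fails to reach \<open>s\<close> exactly when \<open>A\<close> fails to
  reach \<open>s\<close> inside the oriented graph on \<open>{1..m}\<close> (lemma \<open>no_path_iff_entry_set\<close>).

  The set \<open>A\<close> is a function of the edges between \<open>K\<close> and \<open>{1..m}\<close>, so it is independent of the
  orientation inside \<open>{1..m}\<close>. Moreover the events \<open>v \<in> A\<close> depend on disjoint sets of \<open>k\<close> edges
  each, so they are independent, and each of them fails with probability \<open>2\<^sup>-\<^sup>k\<close>. Therefore
  \<open>A = B\<close> has probability
  \<open>(1 - 2\<^sup>-\<^sup>k)\<^sup>i (2\<^sup>-\<^sup>k)\<^sup>m\<^sup>-\<^sup>i\<close> for \<open>i = card B\<close>, which is \<open>(2\<^sup>k - 1)\<^sup>i / 2\<^sup>k\<^sup>m\<close>, and given \<open>A = B\<close> the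
  set \<open>B\<close> fails to reach \<open>s\<close> with probability \<open>f m i\<close> if \<open>s \<notin> B\<close>, and with probability \<open>0\<close>
  otherwise (lemma \<open>prob_entry_set_eq_and_no_path\<close>). The recursion is the sum over all
  \<open>B \<subseteq> {1..m} - {s}\<close>, of which \<open>m - 1 choose i\<close> have size \<open>i\<close>.
\<close>

section \<open>Independence of events that depend on disjoint blocks of coordinates\<close>

definition determined_by :: "'a set \<Rightarrow> (('a \<Rightarrow> 'b) \<Rightarrow> bool) \<Rightarrow> bool" where
  "determined_by D Q \<longleftrightarrow> (\<forall>\<omega> \<omega>'. (\<forall>e\<in>D. \<omega> e = \<omega>' e) \<longrightarrow> Q \<omega> = Q \<omega>')"

lemma determined_byD:
  "determined_by D Q \<Longrightarrow> (\<And>e. e \<in> D \<Longrightarrow> \<omega> e = \<omega>' e) \<Longrightarrow> Q \<omega> = Q \<omega>'"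
  unfolding determined_by_def by blast

lemma determined_by_Ball:
  assumes "\<And>v. v \<in> V \<Longrightarrow> determined_by (D v) (Q v)"
  shows "determined_by (\<Union>v\<in>V. D v) (\<lambda>\<omega>. \<forall>v\<in>V. Q v \<omega>)"
  using assms unfolding determined_by_def by (meson UN_I)

lemma prob_Pi_pmf_marginal:
  assumes "finite E" "D \<subseteq> E" "determined_by D Q"
  shows "measure_pmf.prob (Pi_pmf E d p) {\<omega>. Q \<omega>} = measure_pmf.prob (Pi_pmf D d p) {\<omega>. Q \<omega>}"
proof -
  have "Q (\<lambda>x. if x \<in> D then \<omega> x else d) = Q \<omega>" for \<omega>
    by (rule determined_byD[OF assms(3)]) simp
  then show ?thesis
    by (simp add: Pi_pmf_subset[OF assms(1,2)] vimage_def)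
qed

text \<open>
  The type of the components may be uncountable; intersecting with the countable supports makes
  the product rule for countable events applicable.
\<close>
lemma prob_pair_pmf_times:
  "measure_pmf.prob (pair_pmf M N) (A \<times> B) = measure_pmf.prob M A * measure_pmf.prob N B"
proof -
  have "measure_pmf.prob (pair_pmf M N) (A \<times> B) =
      measure_pmf.prob (pair_pmf M N) ((A \<inter> set_pmf M) \<times> (B \<inter> set_pmf N))"
    by (subst measure_Int_set_pmf[symmetric]) (simp add: Times_Int_Times)
  also have "\<dots> = measure_pmf.prob M (A \<inter> set_pmf M) * measure_pmf.prob N (B \<inter> set_pmf N)"
    by (intro measure_pmf_prob_product) auto
  finally show ?thesis by (simp add: measure_Int_set_pmf)
qed

text \<open>
  The product over the two blocks is the image of a pair of independent product distributions, and
  under this identification the event is a rectangle.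
\<close>
lemma prob_Pi_pmf_conj:
  assumes "finite E" "C \<subseteq> E" "D \<subseteq> E" "C \<inter> D = {}" "determined_by C Q" "determined_by D R"
  shows "measure_pmf.prob (Pi_pmf E d p) {\<omega>. Q \<omega> \<and> R \<omega>} =
    measure_pmf.prob (Pi_pmf E d p) {\<omega>. Q \<omega>} * measure_pmf.prob (Pi_pmf E d p) {\<omega>. R \<omega>}"
proof -
  have fin: "finite C" "finite D"
    using assms(1-3) by (auto intro: finite_subset)
  have "determined_by (C \<union> D) (\<lambda>\<omega>. Q \<omega> \<and> R \<omega>)"
    using assms(5,6) unfolding determined_by_def by (meson UnI1 UnI2)
  then have "measure_pmf.prob (Pi_pmf E d p) {\<omega>. Q \<omega> \<and> R \<omega>} =
      measure_pmf.prob (Pi_pmf (C \<union> D) d p) {\<omega>. Q \<omega> \<and> R \<omega>}"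
    using assms by (intro prob_Pi_pmf_marginal) auto
  also have "\<dots> = measure_pmf.prob (pair_pmf (Pi_pmf C d p) (Pi_pmf D d p))
      {z. Q (\<lambda>x. if x \<in> C then fst z x else snd z x) \<and> R (\<lambda>x. if x \<in> C then fst z x else snd z x)}"
    by (simp add: Pi_pmf_union[OF fin assms(4)] vimage_def case_prod_beta)
  also have "{z. Q (\<lambda>x. if x \<in> C then fst z x else snd z x) \<and> R (\<lambda>x. if x \<in> C then fst z x else snd z x)} =
      {\<omega>. Q \<omega>} \<times> {\<omega>. R \<omega>}"
  proof -
    have "Q (\<lambda>x. if x \<in> C then g x else h x) = Q g" for g h
      by (rule determined_byD[OF assms(5)]) simp
    moreover have "R (\<lambda>x. if x \<in> C then g x else h x) = R h" for g h
      by (rule determined_byD[OF assms(6)]) (use assms(4) in auto)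
    ultimately show ?thesis by auto
  qed
  finally show ?thesis
    using assms by (simp add: prob_pair_pmf_times prob_Pi_pmf_marginal)
qed

lemma prob_Pi_pmf_Ball:
  assumes "finite E" "finite V" "\<And>v. v \<in> V \<Longrightarrow> D v \<subseteq> E" "disjoint_family_on D V"
    and "\<And>v. v \<in> V \<Longrightarrow> determined_by (D v) (Q v)"
  shows "measure_pmf.prob (Pi_pmf E d p) {\<omega>. \<forall>v\<in>V. Q v \<omega>} =
    (\<Prod>v\<in>V. measure_pmf.prob (Pi_pmf E d p) {\<omega>. Q v \<omega>})"
  using assms(2-5)
proof (induction V rule: finite_induct)
  case empty
  then show ?case by simp
next
  case (insert v V)
  have "measure_pmf.prob (Pi_pmf E d p) {\<omega>. Q v \<omega> \<and> (\<forall>v\<in>V. Q v \<omega>)} =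
      measure_pmf.prob (Pi_pmf E d p) {\<omega>. Q v \<omega>} *
      measure_pmf.prob (Pi_pmf E d p) {\<omega>. \<forall>v\<in>V. Q v \<omega>}"
  proof (rule prob_Pi_pmf_conj[where C = "D v" and D = "\<Union>v\<in>V. D v"])
    show "D v \<inter> (\<Union>v\<in>V. D v) = {}"
      using insert.hyps insert.prems(2) by (fastforce simp: disjoint_family_on_def)
    show "determined_by (\<Union>v\<in>V. D v) (\<lambda>\<omega>. \<forall>v\<in>V. Q v \<omega>)"
      by (rule determined_by_Ball) (use insert.prems(3) in auto)
  qed (use assms(1) insert.prems in auto)
  moreover have "disjoint_family_on D V"
    using insert.prems(2) by (auto simp: disjoint_family_on_def)
  ultimately show ?case
    using insert by simp
qed

section \<open>Paths entering a smaller complete graph\<close>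

definition entry_set :: "nat \<Rightarrow> nat \<Rightarrow> (nat set \<Rightarrow> nat) \<Rightarrow> nat set" where
  "entry_set m n \<omega> = {v \<in> {1..m}. \<exists>a\<in>{m<..n}. \<omega> {a, v} = v}"

lemma Kn_edge_pair_iff: "{u, v} \<in> Kn_edges n \<longleftrightarrow> u \<in> {1..n} \<and> v \<in> {1..n} \<and> u \<noteq> v"
  by (auto simp: Kn_edges_def card_insert_if)

text \<open>
  Only the part of a path after its last vertex above \<open>m\<close> matters: it begins in the entry set and
  uses only edges between vertices up to \<open>m\<close>. The equivalence holds for every orientation, so
  that no probability is involved in this step.
\<close>
lemma no_path_iff_entry_set:
  assumes "s \<in> {1..m}" "m \<le> n"
  shows "(\<forall>a\<in>{m<..n}. no_path n \<omega> a s) \<longleftrightarrow> (\<forall>b\<in>entry_set m n \<omega>. no_path m \<omega> b s)"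
proof -
  let ?R = "\<lambda>j. parcs (oriented_Kn j \<omega>)"
  have R: "(u, v) \<in> ?R j \<longleftrightarrow> u \<in> {1..j} \<and> v \<in> {1..j} \<and> u \<noteq> v \<and> \<omega> {u, v} = v" for u v j
    by (auto simp: oriented_Kn_def Kn_edge_pair_iff)
  have mono: "?R m \<subseteq> ?R n"
    using assms(2) by (force simp: R)
  \<comment> \<open>Induction backwards from \<open>s\<close>: the first alternative holds as long as the path has not left
      \<open>{1..m}\<close>; the step at which it leaves provides the entry vertex \<open>b\<close>, which is then kept.\<close>
  have decomp: "x \<in> {1..m} \<and> (x, s) \<in> (?R m)\<^sup>* \<or> (\<exists>b\<in>entry_set m n \<omega>. (b, s) \<in> (?R m)\<^sup>*)"
    if "(x, s) \<in> (?R n)\<^sup>*" for x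
    using that
  proof (induction rule: converse_rtrancl_induct)
    case base
    then show ?case using assms(1) by simp
  next
    case (step x y)
    from step.IH show ?case
    proof
      assume y: "y \<in> {1..m} \<and> (y, s) \<in> (?R m)\<^sup>*"
      show ?thesis
      proof (cases "x \<le> m")
        case True
        then have "(x, y) \<in> ?R m"
          using step.hyps(1) y by (auto simp: R)
        then show ?thesis
          using y by (auto simp: R intro: converse_rtrancl_into_rtrancl)
      next
        case False
        then have "y \<in> entry_set m n \<omega>"
          using step.hyps(1) y by (auto simp: R entry_set_def)
        then show ?thesis using y by blast
      qed
    qed blast
  qed
  have "(\<exists>a\<in>{m<..n}. (a, s) \<in> (?R n)\<^sup>*) \<longleftrightarrow> (\<exists>b\<in>entry_set m n \<omega>. (b, s) \<in> (?R m)\<^sup>*)"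
  proof
    assume "\<exists>a\<in>{m<..n}. (a, s) \<in> (?R n)\<^sup>*"
    then show "\<exists>b\<in>entry_set m n \<omega>. (b, s) \<in> (?R m)\<^sup>*"
      using decomp by fastforce
  next
    assume "\<exists>b\<in>entry_set m n \<omega>. (b, s) \<in> (?R m)\<^sup>*"
    then obtain a b where *: "b \<in> {1..m}" "a \<in> {m<..n}" "\<omega> {a, b} = b" "(b, s) \<in> (?R m)\<^sup>*"
      by (auto simp: entry_set_def)
    then have "(a, b) \<in> ?R n"
      using assms(2) by (auto simp: R)
    moreover have "(b, s) \<in> (?R n)\<^sup>*"
      using *(4) rtrancl_mono[OF mono] by blast
    ultimately show "\<exists>a\<in>{m<..n}. (a, s) \<in> (?R n)\<^sup>*"
      using *(2) converse_rtrancl_into_rtrancl by fast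
  qed
  moreover have "no_path n \<omega> a s \<longleftrightarrow> (a, s) \<notin> (?R n)\<^sup>*" if "a \<in> {m<..n}" for a
    using that by (intro no_path_iff_rtrancl) auto
  moreover have "no_path m \<omega> b s \<longleftrightarrow> (b, s) \<notin> (?R m)\<^sup>*" if "b \<in> entry_set m n \<omega>" for b
    using that by (intro no_path_iff_rtrancl) (auto simp: entry_set_def)
  ultimately show ?thesis by blast
qed

lemma determined_by_no_path:
  "determined_by (Kn_edges n) (\<lambda>\<omega>. no_path n \<omega> u v)"
proof -
  have "oriented_Kn n \<omega> = oriented_Kn n \<omega>'" if "\<forall>e\<in>Kn_edges n. \<omega> e = \<omega>' e" for \<omega> \<omega>'
    using that by (auto simp: oriented_Kn_def)
  then show ?thesis
    unfolding determined_by_def no_path_def by metis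
qed

section \<open>The distribution of the entry set\<close>

text \<open>
  The \<open>n - m\<close> edges that join \<open>v\<close> to the vertices above \<open>m\<close> all have to point away from \<open>v\<close>.
\<close>
lemma prob_no_entry_at:
  assumes "v \<in> {1..m}" "m \<le> n"
  shows "measure_pmf.prob (random_orientation n) {\<omega>. \<forall>a\<in>{m<..n}. \<omega> {a, v} \<noteq> v} = (1 / 2) ^ (n - m)"
proof -
  let ?D = "(\<lambda>a. {a, v}) ` {m<..n}"
  let ?B = "\<lambda>e. if e \<in> ?D then - {v} else UNIV"
  have D: "?D \<subseteq> Kn_edges n"
    using assms by (auto simp: Kn_edge_pair_iff)
  have "{\<omega>. \<forall>a\<in>{m<..n}. \<omega> {a, v} \<noteq> v} = Pi (Kn_edges n) ?B"
    using D by (auto simp: Pi_def)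
  then have "measure_pmf.prob (random_orientation n) {\<omega>. \<forall>a\<in>{m<..n}. \<omega> {a, v} \<noteq> v} =
      (\<Prod>e\<in>Kn_edges n. measure_pmf.prob (pmf_of_set e) (?B e))"
    by (simp only: random_orientation_def measure_Pi_pmf_Pi[OF finite_Kn_edges])
  also have "\<dots> = (\<Prod>e\<in>?D. measure_pmf.prob (pmf_of_set e) (- {v}))"
    using D by (intro prod.mono_neutral_cong_right) auto
  also have "\<dots> = (\<Prod>e\<in>?D. 1 / 2)"
  proof (rule prod.cong[OF refl])
    fix e assume "e \<in> ?D"
    then obtain a where a: "a \<in> {m<..n}" "e = {a, v}" by blast
    then have "{a, v} \<inter> - {v} = {a}" "a \<noteq> v" using assms by auto
    then show "measure_pmf.prob (pmf_of_set e) (- {v}) = 1 / 2"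
      by (simp add: a(2) measure_pmf_of_set)
  qed
  also have "card ?D = n - m"
    by (subst card_image) (auto simp: inj_on_def doubleton_eq_iff)
  then have "(\<Prod>e\<in>?D. 1 / 2 :: real) = (1 / 2) ^ (n - m)"
    by simp
  finally show ?thesis .
qed

definition crossing_edges :: "nat \<Rightarrow> nat \<Rightarrow> nat \<Rightarrow> nat set set" where
  "crossing_edges m n v = (\<lambda>a. {a, v}) ` {m<..n}"

text \<open>
  The entry set depends on the crossing edges only and reachability inside \<open>{1..m}\<close> on the edges
  of the smaller graph only, so the probability factors. The first factor splits further, into one
  factor \<open>1 - 2\<^sup>-\<^sup>j\<close> for each \<open>v \<in> B\<close> and one factor \<open>2\<^sup>-\<^sup>j\<close> for each other \<open>v \<le> m\<close>, where
  \<open>j = n - m\<close>.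
\<close>
lemma prob_entry_set_eq_and_no_path:
  assumes "B \<subseteq> {1..m}" "m \<le> n"
  shows "measure_pmf.prob (random_orientation n)
      {\<omega>. entry_set m n \<omega> = B \<and> (\<forall>b\<in>B. no_path m \<omega> b s)} =
    (2 ^ (n - m) - 1) ^ card B / 2 ^ ((n - m) * m) * prob_no_path m B s"
proof -
  let ?P = "measure_pmf.prob (random_orientation n)"
  let ?D = "\<lambda>v. crossing_edges m n v"
  define Q where "Q = (\<lambda>v \<omega>. (\<exists>a\<in>{m<..n}. \<omega> {a, v} = v) \<longleftrightarrow> v \<in> B)"
  have entry: "entry_set m n \<omega> = B \<longleftrightarrow> (\<forall>v\<in>{1..m}. Q v \<omega>)" for \<omega>
    using assms(1) by (auto simp: entry_set_def Q_def)
  have D: "?D v \<subseteq> Kn_edges n" if "v \<in> {1..m}" for v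
    using that assms(2) by (auto simp: crossing_edges_def Kn_edge_pair_iff)
  have disj: "disjoint_family_on ?D {1..m}"
    by (auto simp: disjoint_family_on_def crossing_edges_def doubleton_eq_iff)
  have detQ: "determined_by (?D v) (Q v)" for v
    by (auto simp: determined_by_def Q_def crossing_edges_def)
  have detN: "determined_by (Kn_edges m) (\<lambda>\<omega>. \<forall>b\<in>B. no_path m \<omega> b s)"
    using determined_by_no_path unfolding determined_by_def by blast
  have sub: "Kn_edges m \<subseteq> Kn_edges n"
    using assms(2) by (force simp: Kn_edges_def)
  have "?P {\<omega>. entry_set m n \<omega> = B \<and> (\<forall>b\<in>B. no_path m \<omega> b s)} =
      ?P {\<omega>. \<forall>v\<in>{1..m}. Q v \<omega>} * ?P {\<omega>. \<forall>b\<in>B. no_path m \<omega> b s}"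
    unfolding entry random_orientation_def
  proof (rule prob_Pi_pmf_conj[OF _ _ sub _ _ detN])
    show "determined_by (\<Union>v\<in>{1..m}. ?D v) (\<lambda>\<omega>. \<forall>v\<in>{1..m}. Q v \<omega>)"
      by (rule determined_by_Ball) (rule detQ)
  qed (use D in \<open>auto simp: crossing_edges_def Kn_edge_pair_iff\<close>)
  moreover have "?P {\<omega>. \<forall>b\<in>B. no_path m \<omega> b s} = prob_no_path m B s"
    unfolding prob_no_path_def random_orientation_def
    by (rule prob_Pi_pmf_marginal[OF _ sub detN]) simp
  moreover have "?P {\<omega>. \<forall>v\<in>{1..m}. Q v \<omega>} = (\<Prod>v\<in>{1..m}. ?P {\<omega>. Q v \<omega>})"
    unfolding random_orientation_def
    by (rule prob_Pi_pmf_Ball[where D = ?D]) (use D disj detQ in auto)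
  moreover have "(\<Prod>v\<in>{1..m}. ?P {\<omega>. Q v \<omega>}) =
      (\<Prod>v\<in>{1..m}. (if v \<in> B then 2 ^ (n - m) - 1 else 1) / 2 ^ (n - m))"
  proof (rule prod.cong[OF refl])
    fix v assume v: "v \<in> {1..m}"
    let ?N = "{\<omega>. \<forall>a\<in>{m<..n}. \<omega> {a, v} \<noteq> v}"
    have N: "?P ?N = 1 / 2 ^ (n - m)"
      using prob_no_entry_at[OF v assms(2)] by (simp add: power_divide)
    show "?P {\<omega>. Q v \<omega>} = (if v \<in> B then 2 ^ (n - m) - 1 else 1) / 2 ^ (n - m)"
    proof (cases "v \<in> B")
      case True
      then have "{\<omega>. Q v \<omega>} = - ?N" by (auto simp: Q_def)
      then have "?P {\<omega>. Q v \<omega>} = 1 - ?P ?N"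
        using measure_pmf.prob_compl[of ?N "random_orientation n"] by (simp add: Compl_eq_Diff_UNIV)
      then show ?thesis using N True by (simp add: diff_divide_distrib)
    next
      case False
      then have "{\<omega>. Q v \<omega>} = ?N" by (auto simp: Q_def)
      then show ?thesis using N False by simp
    qed
  qed
  moreover have "(\<Prod>v\<in>{1..m}. (if v \<in> B then 2 ^ (n - m) - 1 else 1) / 2 ^ (n - m) :: real) =
      (2 ^ (n - m) - 1) ^ card B / 2 ^ ((n - m) * m)"
  proof -
    have "{1..m} \<inter> B = B" using assms(1) by blast
    then have "(\<Prod>v\<in>{1..m}. if v \<in> B then 2 ^ (n - m) - 1 else 1 :: real) = (2 ^ (n - m) - 1) ^ card B"
      by (simp add: prod.If_cases)
    moreover have "(\<Prod>v\<in>{1..m}. 2 ^ (n - m) :: real) = 2 ^ ((n - m) * m)"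
      by (simp flip: power_mult)
    ultimately show ?thesis
      by (simp only: prod_dividef)
  qed
  ultimately show ?thesis
    by (simp only:)
qed

section \<open>The recursion\<close>

lemma sum_Pow_card:
  fixes g :: "nat \<Rightarrow> real"
  assumes "finite S"
  shows "(\<Sum>B\<in>Pow S. g (card B)) = (\<Sum>i = 0..card S. real (card S choose i) * g i)"
proof -
  have "(\<Sum>B\<in>Pow S. g (card B)) = (\<Sum>i = 0..card S. \<Sum>B | B \<in> Pow S \<and> card B = i. g (card B))"
    using assms by (intro sum.group[symmetric]) (auto intro: card_mono)
  also have "\<dots> = (\<Sum>i = 0..card S. real (card S choose i) * g i)"
    using n_subsets[OF assms] by (intro sum.cong) simp_all
  finally show ?thesis .
qed

theorem lemma4p1:
  fixes n k :: nat
  assumes "n \<ge> k + 1" and "k + 1 \<ge> 2"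
  shows "f n k = (\<Sum>i = 0..n - k - 1.
           real ((n - k - 1) choose i) * ((2 ^ k - 1) ^ i / 2 ^ (k * (n - k))) * f (n - k) i)"
proof -
  define m where "m = n - k"
  have m: "1 \<le> m" "m \<le> n" "n - m = k" "1 \<in> {1..m}"
    using assms by (auto simp: m_def)
  let ?P = "measure_pmf.prob (random_orientation n)"
  define F where "F B = {\<omega>. entry_set m n \<omega> = B \<and> (\<forall>b\<in>B. no_path m \<omega> b 1)}" for B
  let ?S = "{1..m} - {1}"
  have refl_path: "\<not> no_path m \<omega> 1 1" for \<omega>
    using m by (simp add: no_path_iff_rtrancl)
  \<comment> \<open>Entry sets that contain \<open>1\<close> are left out: the vertex \<open>1\<close> reaches itself by the empty path.\<close>
  have event: "{\<omega>. \<forall>a\<in>{m<..n}. no_path n \<omega> a 1} = (\<Union>B\<in>Pow ?S. F B)"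
  proof (intro set_eqI)
    fix \<omega>
    have "entry_set m n \<omega> \<subseteq> ?S" if "\<forall>b\<in>entry_set m n \<omega>. no_path m \<omega> b 1"
    proof -
      have "1 \<notin> entry_set m n \<omega>"
        using that refl_path by blast
      then show ?thesis
        unfolding entry_set_def by blast
    qed
    moreover have "\<omega> \<in> (\<Union>B\<in>Pow ?S. F B) \<longleftrightarrow>
        entry_set m n \<omega> \<subseteq> ?S \<and> (\<forall>b\<in>entry_set m n \<omega>. no_path m \<omega> b 1)"
      unfolding F_def by blast
    ultimately show "\<omega> \<in> {\<omega>. \<forall>a\<in>{m<..n}. no_path n \<omega> a 1} \<longleftrightarrow> \<omega> \<in> (\<Union>B\<in>Pow ?S. F B)"
      unfolding mem_Collect_eq no_path_iff_entry_set[OF m(4,2)] by blast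
  qed
  have "f n k = ?P {\<omega>. \<forall>a\<in>{m<..n}. no_path n \<omega> a 1}"
  proof -
    have "{m<..n} \<subseteq> {1..n} - {1}" "1 \<in> {1..n}" "card {m<..n} = k"
      using m by auto
    then show ?thesis
      using f_eq[of 1 n "{m<..n}" k] by (simp add: prob_no_path_def)
  qed
  also have "\<dots> = ?P (\<Union>B\<in>Pow ?S. F B)"
    by (simp only: event)
  also have "\<dots> = (\<Sum>B\<in>Pow ?S. ?P (F B))"
  proof (rule measure_pmf.finite_measure_finite_Union)
    show "disjoint_family_on F (Pow ?S)"
      by (auto simp: disjoint_family_on_def F_def)
  qed auto
  also have "\<dots> = (\<Sum>B\<in>Pow ?S. (2 ^ k - 1) ^ card B / 2 ^ (k * m) * f m (card B))"
  proof (rule sum.cong[OF refl])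
    fix B assume B: "B \<in> Pow ?S"
    then have "B \<subseteq> {1..m}" by blast
    moreover have "f m (card B) = prob_no_path m B 1"
      using B m(4) by (intro f_eq) auto
    ultimately show "?P (F B) = (2 ^ k - 1) ^ card B / 2 ^ (k * m) * f m (card B)"
      using prob_entry_set_eq_and_no_path[of B m n 1] m(2) unfolding F_def m(3) by simp
  qed
  also have "\<dots> = (\<Sum>i = 0..m - 1. real (m - 1 choose i) *
      ((2 ^ k - 1) ^ i / 2 ^ (k * m) * f m i))"
  proof -
    have "card ?S = m - 1"
      using m(4) by simp
    then show ?thesis
      using sum_Pow_card[of ?S "\<lambda>i. (2 ^ k - 1) ^ i / 2 ^ (k * m) * f m i"] by simp
  qed
  finally show ?thesis
    by (simp add: m_def mult.assoc)
qed

end
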